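(* Let $\widehat{\mathcal{L}}$ be the completed Witt Lie algebra. Then $\mathrm{Der}\,\widehat{\mathcal{L}}=\mathrm{ad}\,\widehat{\mathcal{L}}$, i.e. every derivation of $\widehat{\mathcal{L}}$ is inner. In particular, the first cohomology group of $\widehat{\mathcal{L}}$ with coefficients in its adjoint module is trivial, namely $\mathbf{H}^1(\widehat{\mathcal{L}},\widehat{\mathcal{L}})=0$.
   Context: The completed Witt Lie algebra $\widehat{\mathcal{L}}$ is the complex vector space of all formal infinite sums $\sum_{i=-1}^{\infty}a_iL_i$ with $a_i\in\mathbb{C}$ (where $L_i$, $i\ge-1$, are symbols and two sums are equal iff all their coefficients agree), with Lie bracket $$\Big[\sum_{i=-1}^{\infty}a_iL_i,\sum_{i=-1}^{\infty}b_iL_i\Big]=\sum_{i=-1}^{\infty}\Big(\sum_{j=-1}^{i+1}(2j-i)a_{i-j}b_j\Big)L_i,$$ so that $[L_i,L_j]=(j-i)L_{i+j}$. A derivation of $\widehat{\mathcal{L}}$ is a $\mathbb{C}$-linear map $D:\widehat{\mathcal{L}}\to\widehat{\mathcal{L}}$ with $D([x,y])=[D(x),y]+[x,D(y)]$ for all $x,y\in\widehat{\mathcal{L}}$ (no continuity is assumed); $\mathrm{Der}\,\widehat{\mathcal{L}}$ is the set of all derivations. For $x\in\widehat{\mathcal{L}}$, $\mathrm{ad}\,x$ is the (inner) derivation $y\mapsto[x,y]$, and $\mathrm{ad}\,\widehat{\mathcal{L}}=\{\mathrm{ad}\,x\mid x\in\widehat{\mathcal{L}}\}$. *)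

theory Defs
  imports
    Complex_Main
    "HOL-Algebra.Elementary_Groups"
    "HOL-Computational_Algebra.Formal_Power_Series"
begin

section \<open>Lie algebras, derivations, first cohomology\<close>

locale lie_algebra = vector_space scale
  for scale :: "'k::field \<Rightarrow> 'a::ab_group_add \<Rightarrow> 'a" +
  fixes bracket :: "'a \<Rightarrow> 'a \<Rightarrow> 'a"
  assumes linear_bracket_left: "Vector_Spaces.linear scale scale (\<lambda>x. bracket x y)"
    and linear_bracket_right: "Vector_Spaces.linear scale scale (\<lambda>y. bracket x y)"
    and bracket_self: "bracket x x = 0"
    and jacobi: "bracket x (bracket y z) + bracket y (bracket z x) + bracket z (bracket x y) = 0"
begin

definition derivations :: "('a \<Rightarrow> 'a) set" where
  "derivations = {D. Vector_Spaces.linear scale scale D \<and>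
     (\<forall>x y. D (bracket x y) = bracket (D x) y + bracket x (D y))}"

definition ad :: "'a \<Rightarrow> 'a \<Rightarrow> 'a" where
  "ad x = (\<lambda>y. bracket x y)"

definition inner_derivations :: "('a \<Rightarrow> 'a) set" where
  "inner_derivations = range ad"

end

locale lie_module = lie_algebra scale bracket + M: vector_space mscale
  for scale :: "'k::field \<Rightarrow> 'a::ab_group_add \<Rightarrow> 'a"
    and bracket :: "'a \<Rightarrow> 'a \<Rightarrow> 'a"
    and mscale :: "'k \<Rightarrow> 'm::ab_group_add \<Rightarrow> 'm" +
  fixes act :: "'a \<Rightarrow> 'm \<Rightarrow> 'm"
  assumes linear_act_left: "Vector_Spaces.linear scale mscale (\<lambda>x. act x m)"
    and linear_act_right: "Vector_Spaces.linear mscale mscale (\<lambda>m. act x m)"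
    and act_bracket: "act (bracket x y) m = act x (act y m) - act y (act x m)"
begin

text \<open>Low degrees of the (algebraic) Chevalley--Eilenberg complex; no continuity
  is imposed on cochains.\<close>

definition d0 :: "'m \<Rightarrow> 'a \<Rightarrow> 'm" where
  "d0 m = (\<lambda>x. act x m)"

definition d1 :: "('a \<Rightarrow> 'm) \<Rightarrow> 'a \<Rightarrow> 'a \<Rightarrow> 'm" where
  "d1 f = (\<lambda>x y. act x (f y) - act y (f x) - f (bracket x y))"

definition cocycles1 :: "('a \<Rightarrow> 'm) set" where
  "cocycles1 = {f. Vector_Spaces.linear scale mscale f \<and> (\<forall>x y. d1 f x y = 0)}"

definition coboundaries1 :: "('a \<Rightarrow> 'm) set" where
  "coboundaries1 = range d0"

definition cocycle_group1 :: "('a \<Rightarrow> 'm) monoid" where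
  "cocycle_group1 = \<lparr>carrier = cocycles1, monoid.mult = (\<lambda>f g x. f x + g x), one = (\<lambda>x. 0)\<rparr>"

text \<open>The quotient is taken as an additive group; the scalar action is not recorded,
  since it plays no role in the vanishing of the quotient.\<close>

definition cohomology1 :: "('a \<Rightarrow> 'm) set monoid" where
  "cohomology1 = cocycle_group1 Mod coboundaries1"

lemma linear_zero_fun: "Vector_Spaces.linear scale mscale (\<lambda>x. 0)"
  by unfold_locales auto

lemma linear_add_fun:
  assumes "Vector_Spaces.linear scale mscale f" "Vector_Spaces.linear scale mscale g"
  shows "Vector_Spaces.linear scale mscale (\<lambda>x. f x + g x)"
proof -
  interpret f: Vector_Spaces.linear scale mscale f by fact
  interpret g: Vector_Spaces.linear scale mscale g by fact
  show ?thesis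
    by unfold_locales (simp_all add: f.add g.add f.scale g.scale M.scale_right_distrib)
qed

lemma linear_uminus_fun:
  assumes "Vector_Spaces.linear scale mscale f"
  shows "Vector_Spaces.linear scale mscale (\<lambda>x. - f x)"
proof -
  interpret f: Vector_Spaces.linear scale mscale f by fact
  show ?thesis
    by unfold_locales (simp_all add: f.add f.scale)
qed

lemma act_add: "act x (m + n) = act x m + act x n"
  using linear_act_right[of x] by (simp add: Vector_Spaces.linear_iff)

lemma act_zero: "act x 0 = 0"
  using act_add[of x 0 0] by simp

lemma act_uminus: "act x (- m) = - act x m"
  using act_add[of x m "- m"] by (simp add: act_zero eq_neg_iff_add_eq_0 add.commute)

lemma comm_group_cocycle_group1: "comm_group cocycle_group1"
proof (rule comm_groupI)
  fix f assume f: "f \<in> carrier cocycle_group1"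
  then have "(\<lambda>x. - f x) \<in> cocycles1"
    by (auto simp: cocycle_group1_def cocycles1_def d1_def linear_uminus_fun act_uminus)
      (metis add_diff_cancel_left' diff_add_cancel diff_diff_eq2 diff_minus_eq_add minus_diff_eq)
  then show "\<exists>g\<in>carrier cocycle_group1. g \<otimes>\<^bsub>cocycle_group1\<^esub> f = \<one>\<^bsub>cocycle_group1\<^esub>"
    by (intro bexI[of _ "\<lambda>x. - f x"]) (simp_all add: cocycle_group1_def)
next
  fix f g assume fg: "f \<in> carrier cocycle_group1" "g \<in> carrier cocycle_group1"
  have "d1 (\<lambda>x. f x + g x) x y = d1 f x y + d1 g x y" for x y
    by (simp add: d1_def act_add algebra_simps)
  then show "f \<otimes>\<^bsub>cocycle_group1\<^esub> g \<in> carrier cocycle_group1"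
    using fg by (simp add: cocycle_group1_def cocycles1_def linear_add_fun)
qed (auto simp: cocycle_group1_def cocycles1_def d1_def linear_zero_fun act_zero algebra_simps)

lemma coboundaries1_subset: "coboundaries1 \<subseteq> cocycles1"
  by (auto simp: coboundaries1_def cocycles1_def d0_def d1_def linear_act_left act_bracket)

lemma normal_coboundaries1: "coboundaries1 \<lhd> cocycle_group1"
proof -
  interpret comm_group cocycle_group1 by (rule comm_group_cocycle_group1)
  have mem: "d0 m \<in> carrier cocycle_group1" for m
    using coboundaries1_subset by (auto simp: cocycle_group1_def coboundaries1_def)
  have mult: "d0 m \<otimes>\<^bsub>cocycle_group1\<^esub> d0 n = d0 (m + n)" for m n
    by (simp add: cocycle_group1_def d0_def act_add)
  have one: "\<one>\<^bsub>cocycle_group1\<^esub> = d0 0"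
    by (simp add: cocycle_group1_def d0_def act_zero)
  have inv: "inv\<^bsub>cocycle_group1\<^esub> d0 m = d0 (- m)" for m
    by (rule inv_equality) (simp_all add: mult one mem)
  have "subgroup coboundaries1 cocycle_group1"
    by (rule subgroup.intro) (auto simp: coboundaries1_def mem mult one inv)
  then show ?thesis
    by (rule subgroup_imp_normal)
qed

lemma group_cohomology1: "group cohomology1"
  unfolding cohomology1_def
  using normal.factorgroup_is_group[OF normal_coboundaries1] .

end

sublocale lie_algebra \<subseteq> adjoint: lie_module scale bracket scale bracket
proof unfold_locales
  have anti: "bracket x y = - bracket y x" for x y
  proof -
    have "bracket (x + y) z = bracket x z + bracket y z"
      and "bracket z (x + y) = bracket z x + bracket z y" for z
      using linear_bracket_left linear_bracket_right
      by (simp_all add: Vector_Spaces.linear_iff)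
    then have "bracket x y + bracket y x = 0"
      using bracket_self[of "x + y"] bracket_self[of x] bracket_self[of y]
      by (simp add: add.commute)
    then show ?thesis by (simp add: eq_neg_iff_add_eq_0)
  qed
  have neg: "bracket x (- y) = - bracket x y" for x y
    by (rule module_hom.neg[OF module_hom_linearI[OF linear_bracket_right]])
  show "bracket (bracket x y) z = bracket x (bracket y z) - bracket y (bracket x z)" for x y z
  proof -
    have "bracket y (bracket z x) = - bracket y (bracket x z)"
      by (metis anti neg)
    moreover have "bracket z (bracket x y) = - bracket (bracket x y) z"
      by (rule anti)
    ultimately show ?thesis
      using jacobi[of x y z] by (simp add: algebra_simps)
  qed
qed (use linear_bracket_left linear_bracket_right in
      \<open>auto simp: Vector_Spaces.linear_iff\<close>)

section \<open>The completed Witt Lie algebra\<close>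

text \<open>The formal sum of the \<open>a\<^sub>i L\<^sub>i\<close>, \<open>i \<ge> -1\<close>, is represented by its coefficient
  function, extended by \<open>0\<close> to indices below \<open>-1\<close>.\<close>

typedef witt_hat = "{a :: int \<Rightarrow> complex. \<forall>i < -1. a i = 0}"
  morphisms coeff Abs_witt_hat
  by (rule exI[of _ "\<lambda>_. 0"]) simp

setup_lifting type_definition_witt_hat

lemma coeff_below: "i < -1 \<Longrightarrow> coeff x i = 0"
  using coeff[of x] by simp

lemma witt_hat_eqI: "(\<And>i. i \<ge> -1 \<Longrightarrow> coeff x i = coeff y i) \<Longrightarrow> x = y"
  by (metis coeff_below coeff_inject ext not_le)

instantiation witt_hat :: ab_group_add
begin

lift_definition zero_witt_hat :: witt_hat is "\<lambda>_. 0" by simp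
lift_definition plus_witt_hat :: "witt_hat \<Rightarrow> witt_hat \<Rightarrow> witt_hat" is "\<lambda>a b i. a i + b i" by simp
lift_definition minus_witt_hat :: "witt_hat \<Rightarrow> witt_hat \<Rightarrow> witt_hat" is "\<lambda>a b i. a i - b i" by simp
lift_definition uminus_witt_hat :: "witt_hat \<Rightarrow> witt_hat" is "\<lambda>a i. - a i" by simp

instance
  by standard (transfer; simp add: fun_eq_iff)+

end

lift_definition witt_scale :: "complex \<Rightarrow> witt_hat \<Rightarrow> witt_hat" is "\<lambda>c a i. c * a i" by simp

text \<open>For \<open>i < -1\<close> the sum below is empty or (\<open>i = -2\<close>) consists of one zero term.\<close>

lift_definition witt_bracket :: "witt_hat \<Rightarrow> witt_hat \<Rightarrow> witt_hat" is
  "\<lambda>a b i. \<Sum>j = -1..i + 1. of_int (2 * j - i) * a (i - j) * b j"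
proof -
  fix a b :: "int \<Rightarrow> complex" and i :: int assume "i < -1"
  then consider "i = -2" | "i < -2" by linarith
  then show "(\<Sum>j = -1..i + 1. of_int (2 * j - i) * a (i - j) * b j) = 0"
    by cases simp_all
qed

lift_definition witt_L :: "int \<Rightarrow> witt_hat" is
  "\<lambda>k i. if i \<ge> -1 \<and> i = k then 1 else 0" by simp

lemma witt_L_bracket:
  assumes "m \<ge> -1" "n \<ge> -1"
  shows "witt_bracket (witt_L m) (witt_L n) = witt_scale (of_int (n - m)) (witt_L (m + n))"
proof (rule witt_hat_eqI)
  fix i :: int assume i: "i \<ge> -1"
  have "coeff (witt_bracket (witt_L m) (witt_L n)) i =
      (\<Sum>j = -1..i + 1. if j = n then (if i = m + n then of_int (n - m) else 0) else 0)"
    unfolding witt_bracket.rep_eq witt_L.rep_eq using assms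
    by (intro sum.cong) auto
  also have "\<dots> = coeff (witt_scale (of_int (n - m)) (witt_L (m + n))) i"
    using assms i by (auto simp: witt_scale.rep_eq witt_L.rep_eq)
  finally show "coeff (witt_bracket (witt_L m) (witt_L n)) i
      = coeff (witt_scale (of_int (n - m)) (witt_L (m + n))) i" .
qed

text \<open>The realisation of \<open>L\<^sub>i\<close> as the vector field \<open>t\<^sup>i\<^sup>+\<^sup>1 d/dt\<close>, used for the Jacobi identity.\<close>

definition to_fps :: "witt_hat \<Rightarrow> complex fps" where
  "to_fps x = Abs_fps (\<lambda>n. coeff x (int n - 1))"

lemma to_fps_nth: "fps_nth (to_fps x) n = coeff x (int n - 1)"
  by (simp add: to_fps_def)

lemma inj_to_fps: "to_fps x = to_fps y \<Longrightarrow> x = y"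
proof (rule witt_hat_eqI)
  fix i :: int assume "to_fps x = to_fps y" "i \<ge> -1"
  then show "coeff x i = coeff y i"
    using to_fps_nth[of x "nat (i + 1)"] to_fps_nth[of y "nat (i + 1)"] by simp
qed

lemma to_fps_zero: "to_fps 0 = 0"
  by (simp add: fps_eq_iff to_fps_nth zero_witt_hat.rep_eq)

lemma to_fps_add: "to_fps (x + y) = to_fps x + to_fps y"
  by (simp add: fps_eq_iff to_fps_nth plus_witt_hat.rep_eq)

lemma to_fps_scale: "to_fps (witt_scale c x) = fps_const c * to_fps x"
  by (simp add: fps_eq_iff to_fps_nth witt_scale.rep_eq)

lemma to_fps_bracket:
  "to_fps (witt_bracket x y) = to_fps x * fps_deriv (to_fps y) - to_fps y * fps_deriv (to_fps x)"
proof (rule fps_ext)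
  fix n
  let ?A = "fps_nth (to_fps x)" and ?B = "fps_nth (to_fps y)"
  have shift: "fps_nth (f * fps_deriv g) n
      = (\<Sum>k\<le>Suc n. of_nat k * fps_nth g k * fps_nth f (Suc n - k))" for f g :: "complex fps"
  proof -
    have "fps_nth (f * fps_deriv g) n = fps_nth (fps_deriv g * f) n"
      by (simp add: mult.commute)
    also have "\<dots> = (\<Sum>k\<le>n. of_nat (Suc k) * fps_nth g (Suc k) * fps_nth f (n - k))"
      by (simp add: fps_mult_nth atLeast0AtMost)
    also have "\<dots> = (\<Sum>k\<le>Suc n. of_nat k * fps_nth g k * fps_nth f (Suc n - k))"
      unfolding sum.atMost_Suc_shift by simp
    finally show ?thesis .
  qed
  have rev: "(\<Sum>k\<le>Suc n. of_nat k * ?A k * ?B (Suc n - k))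
      = (\<Sum>k\<le>Suc n. of_nat (Suc n - k) * ?A (Suc n - k) * ?B k)"
    by (rule sum.reindex_bij_witness[of _ "\<lambda>k. Suc n - k" "\<lambda>k. Suc n - k"]) auto
  have "fps_nth (to_fps (witt_bracket x y)) n
      = (\<Sum>j = -1..int n. of_int (2 * j - (int n - 1)) * coeff x (int n - 1 - j) * coeff y j)"
    by (simp add: to_fps_nth witt_bracket.rep_eq)
  also have "\<dots> = (\<Sum>k\<le>Suc n. (of_nat k - of_nat (Suc n - k)) * ?A (Suc n - k) * ?B k)"
    by (rule sum.reindex_bij_witness[of _ "\<lambda>k. int k - 1" "\<lambda>j. nat (j + 1)"])
      (auto simp: to_fps_nth of_nat_diff algebra_simps nat_le_iff)
  also have "\<dots> = fps_nth (to_fps x * fps_deriv (to_fps y)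
      - to_fps y * fps_deriv (to_fps x)) n"
    by (simp only: shift rev fps_sub_nth sum_subtractf[symmetric])
      (simp add: algebra_simps)
  finally show "fps_nth (to_fps (witt_bracket x y)) n
      = fps_nth (to_fps x * fps_deriv (to_fps y) - to_fps y * fps_deriv (to_fps x)) n" .
qed

lemma vector_space_witt_scale: "vector_space witt_scale"
  by standard (transfer; simp add: fun_eq_iff algebra_simps)+

global_interpretation witt: lie_algebra witt_scale witt_bracket
proof -
  interpret vector_space witt_scale by (rule vector_space_witt_scale)
  note fps = to_fps_bracket to_fps_add to_fps_scale to_fps_zero fps_deriv_mult
  show "lie_algebra witt_scale witt_bracket"
  proof unfold_locales
    show "witt_bracket x x = 0" for x
      by (rule inj_to_fps) (simp add: fps)
    show "witt_bracket x (witt_bracket y z) + witt_bracket y (witt_bracket z x)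
        + witt_bracket z (witt_bracket x y) = 0" for x y z
      by (rule inj_to_fps) (simp add: fps algebra_simps)
  qed (auto intro!: inj_to_fps simp: fps algebra_simps)
qed

end

theory Submission
  imports Defs
begin

text \<open>
  Under \<open>L\<^sub>i \<mapsto> t\<^sup>i\<^sup>+\<^sup>1\<close> the completed Witt algebra is the space of formal power
  series with bracket \<open>[f, g] = f g' - g f'\<close>. Let \<open>D\<close> be a derivation of it. Since
  \<open>[1, g] = g'\<close> and formal power series have antiderivatives, subtracting an inner derivation
  makes \<open>D\<close> vanish on \<open>1\<close> and on \<open>t\<close>. From \<open>D 1 = 0\<close> it follows that
  \<open>D\<close> commutes with \<open>d/dt\<close>, and from \<open>D t = 0\<close> that it preserves the weight spaces of
  \<open>[t, \<cdot>]\<close>; together these force \<open>D (t\<^sup>2) = D (t\<^sup>3) = 0\<close>.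

  As \<open>D\<close> is not assumed to be continuous, its vanishing on polynomials does not settle the
  matter. What replaces continuity is that \<open>[t\<^sup>2, \<cdot>]\<close> hits every series up to multiples of
  \<open>1\<close> and \<open>t\<^sup>3\<close>: writing \<open>f = a + b t\<^sup>3 + [t\<^sup>2, h]\<close> gives \<open>D f = [t\<^sup>2, D h]\<close>, whose
  constant term is zero. So \<open>D f\<close> has no constant term, for every \<open>f\<close>; and as \<open>D\<close> commutes with
  \<open>d/dt\<close>, no coefficient of \<open>D f\<close> survives (lemma \<open>normalized_derivation_eq_0\<close>).

  The cohomological statement is formal: for any Lie algebra, the 1-cocycles with values in the
  adjoint module are the derivations and the 1-coboundaries are the inner ones.
\<close>

definition fps_bracket :: "'a::field_char_0 fps \<Rightarrow> 'a fps \<Rightarrow> 'a fps" where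
  "fps_bracket f g = f * fps_deriv g - g * fps_deriv f"

text \<open>On \<open>t\<^sup>n\<close> the operator \<open>[t\<^sup>2, \<cdot>]\<close> is \<open>(n - 2) t\<^sup>n\<^sup>+\<^sup>1\<close>, so its image misses exactly
  the coefficients of \<open>1\<close> and \<open>t\<^sup>3\<close>.\<close>

lemma fps_decompose_bracket_X2:
  fixes f :: "'a::field_char_0 fps"
  shows "\<exists>h. f = fps_const (fps_nth f 0) + fps_const (fps_nth f 3) * fps_X ^ 3
                 + fps_bracket (fps_X ^ 2) h"
proof
  \<comment> \<open>At \<open>n = 2\<close> the denominator is zero; that coefficient is killed by \<open>[t\<^sup>2, \<cdot>]\<close>, so its value is immaterial.\<close>
  let ?h = "Abs_fps (\<lambda>n. fps_nth f (Suc n) / (of_nat n - 2))"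
  have X2: "fps_bracket (fps_X ^ 2) ?h = fps_X * (fps_X * fps_deriv ?h - 2 * ?h)"
    by (simp add: fps_bracket_def fps_deriv_power algebra_simps power2_eq_square)
  have nth: "fps_nth (fps_X * fps_deriv ?h - 2 * ?h) n
             = (of_nat n - 2) * fps_nth ?h n" for n
  proof (cases n)
    case 0
    then show ?thesis by (simp add: numeral_fps_const)
  next
    case (Suc m)
    then have "fps_nth (fps_X * fps_deriv ?h - 2 * ?h) n
               = of_nat n * fps_nth ?h n - 2 * fps_nth ?h n"
      by (simp add: numeral_fps_const del: of_nat_Suc)
    then show ?thesis
      by (simp only: left_diff_distrib)
  qed
  show "f = fps_const (fps_nth f 0) + fps_const (fps_nth f 3) * fps_X ^ 3
            + fps_bracket (fps_X ^ 2) ?h"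
  proof (rule fps_ext)
    fix n
    show "fps_nth f n = fps_nth (fps_const (fps_nth f 0) + fps_const (fps_nth f 3) * fps_X ^ 3
            + fps_bracket (fps_X ^ 2) ?h) n"
    proof (cases n)
      case 0
      then show ?thesis by (simp add: X2)
    next
      case (Suc m)
      have "of_nat m = (2::'a) \<longleftrightarrow> m = 2"
        by (metis of_nat_eq_iff of_nat_numeral)
      then show ?thesis
        unfolding X2 Suc by (auto simp: fps_X_power_nth nth simp del: fps_sub_nth)
    qed
  qed
qed

locale fps_bracket_derivation =
  fixes D :: "'a::field_char_0 fps \<Rightarrow> 'a fps"
  assumes add: "D (f + g) = D f + D g"
    and scale: "D (fps_const c * f) = fps_const c * D f"
    and bracket: "D (fps_bracket f g) = fps_bracket (D f) g + fps_bracket f (D g)"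
begin

lemma diff_inner:
  "fps_bracket_derivation (\<lambda>f. D f - fps_bracket u f)"
proof
  \<comment> \<open>This is the Jacobi identity.\<close>
  have "fps_bracket u (fps_bracket f g)
        = fps_bracket (fps_bracket u f) g + fps_bracket f (fps_bracket u g)" for f g
    by (simp add: fps_bracket_def algebra_simps)
  then show "D (fps_bracket f g) - fps_bracket u (fps_bracket f g)
      = fps_bracket (D f - fps_bracket u f) g + fps_bracket f (D g - fps_bracket u g)" for f g
    by (simp only: bracket) (simp add: fps_bracket_def algebra_simps)
qed (simp_all only: add scale, simp_all add: fps_bracket_def algebra_simps)

text \<open>Since \<open>D t = 0\<close>, \<open>D\<close> commutes with \<open>[t, \<cdot>]\<close>, which has eigenvalue \<open>n - 1\<close> on \<open>t\<^sup>n\<close>.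
  Hence \<open>D (t\<^sup>n)\<close> has eigenvalue \<open>n - 1\<close> or is zero, whereas a nonzero constant has eigenvalue \<open>-1\<close>.\<close>

lemma X_power_eq_0:
  assumes X: "D fps_X = 0" and "D (fps_X ^ n) = fps_const c" and "n > 0"
  shows "D (fps_X ^ n) = 0"
proof -
  have "fps_bracket fps_X (fps_X ^ n) = fps_const (of_nat n - 1) * (fps_X ^ n :: 'a fps)"
  proof (rule fps_ext)
    fix k
    have "fps_nth (fps_X * fps_deriv (fps_X ^ n)) k = of_nat k * fps_nth (fps_X ^ n :: 'a fps) k"
      by (cases k) simp_all
    then show "fps_nth (fps_bracket fps_X (fps_X ^ n)) k
               = fps_nth (fps_const (of_nat n - 1) * fps_X ^ n :: 'a fps) k"
      by (simp only: fps_bracket_def fps_sub_nth) (simp add: fps_X_power_nth)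
  qed
  then have "fps_const (of_nat n - 1) * D (fps_X ^ n) = D (fps_bracket fps_X (fps_X ^ n))"
    by (simp add: scale)
  also have "\<dots> = - D (fps_X ^ n)"
    by (simp add: bracket X assms(2)) (simp add: fps_bracket_def)
  finally have "fps_const (of_nat n - 1) * fps_const c = - fps_const c"
    by (simp only: assms(2))
  then have "fps_nth (fps_const (of_nat n - 1) * fps_const c) 0 = fps_nth (- fps_const c) 0"
    by (rule arg_cong)
  then have "of_nat n * c = 0"
    by (simp add: algebra_simps)
  then show ?thesis
    using assms(2,3) by simp
qed

text \<open>As \<open>D\<close> vanishes on \<open>1\<close>, \<open>t\<^sup>2\<close> and \<open>t\<^sup>3\<close>, applying it to the decomposition
  \<open>fps_decompose_bracket_X2\<close> shows that no \<open>D f\<close> has a constant term. The coefficient of \<open>t\<^sup>n\<close> in \<open>D f\<close> is, up to the factor \<open>n!\<close>, the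
  constant term of \<open>D\<close> applied to the \<open>n\<close>-th derivative of \<open>f\<close>, so it vanishes too.\<close>

lemma normalized_derivation_eq_0:
  assumes one: "D 1 = 0" and X: "D fps_X = 0"
  shows "D f = 0"
proof -
  have deriv: "D (fps_deriv g) = fps_deriv (D g)" for g
    using bracket[of 1 g] by (simp add: fps_bracket_def one)
  have const: "D (fps_const c) = 0" for c
    using scale[of c 1] by (simp add: one)
  have deriv_0: "D g = fps_const (fps_nth (D g) 0)" if "D (fps_deriv g) = 0" for g
    using that by (simp add: deriv fps_deriv_eq_0_iff)
  have X2: "D (fps_X ^ 2) = 0"
  proof (rule X_power_eq_0[OF X deriv_0])
    have "fps_deriv (fps_X ^ 2) = fps_const 2 * (fps_X :: 'a fps)"
      by (simp add: fps_deriv_power numeral_fps_const)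
    then show "D (fps_deriv (fps_X ^ 2)) = 0"
      by (simp add: scale X)
  qed simp
  have X3: "D (fps_X ^ 3) = 0"
  proof (rule X_power_eq_0[OF X deriv_0])
    have "fps_deriv (fps_X ^ 3) = fps_const 3 * (fps_X ^ 2 :: 'a fps)"
      by (simp add: fps_deriv_power numeral_fps_const)
    then show "D (fps_deriv (fps_X ^ 3)) = 0"
      by (simp add: scale X2)
  qed simp
  have const_term: "fps_nth (D g) 0 = 0" for g
  proof -
    obtain h where "g = fps_const (fps_nth g 0) + fps_const (fps_nth g 3) * fps_X ^ 3
                        + fps_bracket (fps_X ^ 2) h"
      using fps_decompose_bracket_X2 by blast
    then have "D g = D (fps_const (fps_nth g 0) + fps_const (fps_nth g 3) * fps_X ^ 3
                        + fps_bracket (fps_X ^ 2) h)"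
      by (rule arg_cong)
    also have "\<dots> = fps_bracket (fps_X ^ 2) (D h)"
      by (simp add: add scale const X3 bracket X2) (simp add: fps_bracket_def)
    finally show ?thesis
      by (simp add: fps_bracket_def fps_deriv_power)
  qed
  have "fps_nth (D g) n = 0" for g n
  proof (induction n arbitrary: g)
    case 0
    show ?case by (rule const_term)
  next
    case (Suc n)
    have "of_nat (Suc n) * fps_nth (D g) (Suc n) = fps_nth (D (fps_deriv g)) n"
      by (simp add: deriv)
    then show ?case
      using Suc.IH by (simp del: of_nat_Suc)
  qed
  then show ?thesis
    by (simp add: fps_eq_iff)
qed

theorem inner: "\<exists>u. \<forall>f. D f = fps_bracket u f"
proof -
  \<comment> \<open>\<open>[u, 1] = - u'\<close>, so \<open>v\<close> corrects \<open>D\<close> at \<open>1\<close>.\<close>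
  define v where "v = - fps_integral (D 1) 0"
  define E where "E = (\<lambda>f. D f - fps_bracket v f)"
  interpret E: fps_bracket_derivation E
    unfolding E_def by (rule diff_inner)
  have E1: "E 1 = 0"
    by (simp add: E_def v_def fps_bracket_def fps_deriv_fps_integral)
  \<comment> \<open>\<open>E\<close> now commutes with \<open>d/dt\<close>, so \<open>E t\<close> is a constant \<open>c = [c, t]\<close>; constants bracket
    trivially with \<open>1\<close>.\<close>
  have "fps_deriv (E fps_X) = 0"
    using E.bracket[of 1 fps_X] by (simp add: fps_bracket_def E1)
  then obtain c where c: "E fps_X = fps_const c"
    by (auto simp: fps_deriv_eq_0_iff)
  interpret F: fps_bracket_derivation "\<lambda>f. E f - fps_bracket (fps_const c) f"
    by (rule E.diff_inner)
  have "E f - fps_bracket (fps_const c) f = 0" for f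
    by (rule F.normalized_derivation_eq_0) (simp_all add: E1 c, simp_all add: fps_bracket_def)
  then have "D f = fps_bracket (v + fps_const c) f" for f
    by (simp add: E_def fps_bracket_def algebra_simps)
  then show ?thesis
    by blast
qed

end

definition of_fps :: "complex fps \<Rightarrow> witt_hat" where
  "of_fps f = Abs_witt_hat (\<lambda>i. if i < -1 then 0 else fps_nth f (nat (i + 1)))"

lemma to_fps_of_fps [simp]: "to_fps (of_fps f) = f"
  by (simp add: fps_eq_iff to_fps_nth of_fps_def Abs_witt_hat_inverse)

lemma of_fps_to_fps [simp]: "of_fps (to_fps x) = x"
  by (rule inj_to_fps) simp

lemma to_fps_witt_bracket: "to_fps (witt_bracket x y) = fps_bracket (to_fps x) (to_fps y)"
  by (simp add: to_fps_bracket fps_bracket_def)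

lemma witt_derivation_inner:
  assumes "D \<in> witt.derivations"
  shows "D \<in> witt.inner_derivations"
proof -
  have lin: "Vector_Spaces.linear witt_scale witt_scale D"
    and der: "D (witt_bracket x y) = witt_bracket (D x) y + witt_bracket x (D y)" for x y
    using assms by (auto simp: witt.derivations_def)
  have hom: "of_fps (f + g) = of_fps f + of_fps g"
    "of_fps (fps_const c * f) = witt_scale c (of_fps f)"
    "of_fps (fps_bracket f g) = witt_bracket (of_fps f) (of_fps g)" for f g c
    by (rule inj_to_fps, simp add: to_fps_add to_fps_scale to_fps_witt_bracket)+
  interpret fps_bracket_derivation "\<lambda>f. to_fps (D (of_fps f))"
    using lin
    by unfold_locales
      (simp_all add: hom der Vector_Spaces.linear_iff to_fps_add to_fps_scale to_fps_witt_bracket)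
  obtain u where u: "to_fps (D (of_fps f)) = fps_bracket u f" for f
    using inner by blast
  have "D x = witt.ad (of_fps u) x" for x
    using u[of "to_fps x"]
    by (intro inj_to_fps) (simp add: witt.ad_def to_fps_witt_bracket)
  then show ?thesis
    by (auto simp: witt.inner_derivations_def)
qed

context lie_algebra
begin

lemma bracket_anticommute: "bracket x y = - bracket y x"
proof -
  have "bracket (x + y) z = bracket x z + bracket y z"
    and "bracket z (x + y) = bracket z x + bracket z y" for z
    using linear_bracket_left linear_bracket_right
    by (simp_all add: Vector_Spaces.linear_iff)
  then have "bracket x y + bracket y x = 0"
    using bracket_self[of "x + y"] bracket_self[of x] bracket_self[of y]
    by (simp add: add.commute)
  then show ?thesis by (simp add: eq_neg_iff_add_eq_0)
qed

lemma adjoint_cocycles1: "adjoint.cocycles1 = derivations"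
proof -
  have "adjoint.d1 f x y = bracket (f x) y + bracket x (f y) - f (bracket x y)" for f x y
    using bracket_anticommute[of y "f x"] by (simp add: adjoint.d1_def)
  then show ?thesis
    by (auto simp: adjoint.cocycles1_def derivations_def)
qed

lemma adjoint_coboundaries1: "adjoint.coboundaries1 = inner_derivations"
proof -
  have "adjoint.d0 = ad \<circ> uminus"
  proof (intro ext)
    fix m x
    have "bracket x m = - bracket x (- m)"
      using adjoint.act_uminus[of x "- m"] by simp
    also have "\<dots> = bracket (- m) x"
      using bracket_anticommute[of "- m" x] by simp
    finally show "adjoint.d0 m x = (ad \<circ> uminus) m x"
      by (simp add: adjoint.d0_def ad_def)
  qed
  then have "range adjoint.d0 = range ad"
    by (simp only: surj_uminus flip: image_comp)
  then show ?thesis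
    by (simp add: adjoint.coboundaries1_def inner_derivations_def)
qed

lemma inner_derivations_subset: "inner_derivations \<subseteq> derivations"
  using adjoint.coboundaries1_subset
  by (simp add: adjoint_cocycles1 adjoint_coboundaries1)

end

lemma (in lie_module) trivial_cohomology1:
  assumes "cocycles1 = coboundaries1"
  shows "trivial_group cohomology1"
proof -
  interpret normal coboundaries1 cocycle_group1 by (rule normal_coboundaries1)
  have "coboundaries1 #>\<^bsub>cocycle_group1\<^esub> f = coboundaries1"
    if "f \<in> carrier cocycle_group1" for f
    using that assms by (intro coset_join2 subgroup_axioms) (simp_all add: cocycle_group1_def)
  then have "carrier cohomology1 \<subseteq> {\<one>\<^bsub>cohomology1\<^esub>}"
    by (auto simp: cohomology1_def FactGroup_def RCOSETS_def)
  then show ?thesis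
    by (simp add: group.trivial_group_subset[OF group_cohomology1])
qed

theorem theorem4p1:
  shows "witt.derivations = witt.inner_derivations \<and>
         trivial_group witt.adjoint.cohomology1"
proof
  show "witt.derivations = witt.inner_derivations"
    using witt_derivation_inner witt.inner_derivations_subset by blast
  then show "trivial_group witt.adjoint.cohomology1"
    by (intro witt.adjoint.trivial_cohomology1)
      (simp add: witt.adjoint_cocycles1 witt.adjoint_coboundaries1)
qed

end
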